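(* Let $g\in\mathcal G$, $\alpha\in(0,1)$, $w\in(0,1]$, $\lambda>0$, and suppose $X=x$ is observed. If $|x|\le t_\alpha$, then $\operatorname{HPD}_\alpha(x)=\{0\}$. Otherwise (i.e. if $|x|>t_\alpha$), $$\operatorname{HPD}_\alpha(x)=\big([\operatorname{L}_\alpha(x),\operatorname{U}_\alpha(x)]\setminus(-\lambda,\lambda)\big)\cup\big(\{0\}\setminus\{1-w\}\big),$$ where $$\operatorname{U}_\alpha(x)=\begin{cases} x+R_1(x), & x\in\mathcal X_{\mathrm I},\\ x+R_2(x), & x\in\mathcal X_{\mathrm{II}},\\ x+R_3(x), & x\in\mathcal X_{\mathrm{III}},\\ -\lambda, & x\in\mathcal X_{\mathrm{IV}},\end{cases}\qquad\text{and}\qquad \operatorname{L}_\alpha(x)=-\operatorname{U}_\alpha(-x).$$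
   Context: $\mathcal G$ is the class of positive continuous probability densities $g$ on $\mathbb R$ that are symmetric around zero and strictly decreasing on $[0,\infty)$. $G$ is the c.d.f. of $g$ and $G^{-1}$ its inverse on $(0,1)$, extended by $G^{-1}(p)=+\infty$ for $p\ge1$ and $G^{-1}(p)=-\infty$ for $p\le0$. Model: $X=\theta+\varepsilon$ with $\varepsilon$ having density $g$. The ($\theta$-min) prior is the improper prior $\pi(\theta)\propto(1-w)\delta_0(\theta)+w\mathbf 1(|\theta|>\lambda)$, with $\delta_0$ the Dirac mass at $0$. Put $\Delta_\lambda(x)=G(\lambda-x)-G(-\lambda-x)$. The posterior $\Pi(\cdot|X=x)$ has a point mass at zero of size $$\Pi(0|X=x)=\frac{(1-w)g(x)}{(1-w)g(x)+w(1-\Delta_\lambda(x))}$$ and, apart from it, the Lebesgue density $\theta\mapsto \dfrac{w\,g(x-\theta)\mathbf 1(|\theta|>\lambda)}{(1-w)g(x)+w(1-\Delta_\lambda(x))}$. Highest posterior density credible set $\operatorname{HPD}_\alpha(x)$: if $\Pi(0|X=x)\ge1-\alpha$, it is $\{0\}$. Otherwise it is the union of $\{0\}$ (omitted if $w=1$) and the closed posterior level set $A_c=\{\theta:|\theta|\ge\lambda,\ g(x-\theta)\ge c\}$, where $c$ is chosen such that $\Pi(A_c|X=x)=1-\alpha-\Pi(0|X=x)$. $t_\alpha=t_\alpha(g,\lambda,w)$ is the (unique, if it exists) non-negative solution $t$ of $\frac{w}{1-w}\frac{G(t-\lambda)+G(-t-\lambda)}{g(t)}=\frac{\alpha}{1-\alpha}$;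 if no such solution exists (in particular if $w=1$), $t_\alpha=-\infty$. Define $$R_1(x)=G^{-1}\Big(1-\tfrac\alpha2-\tfrac{1-w}{2w}\alpha g(x)-\tfrac{1-\alpha}2\Delta_\lambda(x)\Big),$$ $$R_2(x)=G^{-1}\Big(1-\alpha-\tfrac{1-w}{w}\alpha g(x)+\alpha\Delta_\lambda(x)+G(-\lambda-x)\Big),$$ $$R_3(x)=G^{-1}\Big(1-\tfrac\alpha2-\tfrac{1-w}{2w}\alpha g(x)+\tfrac\alpha2\Delta_\lambda(x)\Big).$$ With $\mathcal T_\alpha=\{x:|x|>t_\alpha\}$, the regimes (which partition $\mathcal T_\alpha$) are $\mathcal X_{\mathrm I}=\{x\in\mathcal T_\alpha:|x|>\lambda+R_1(x)\}$, $\mathcal X_{\mathrm{II}}=\{x\in\mathcal T_\alpha:-\lambda+R_3(x)<x\le\lambda+R_1(x)\}$, $\mathcal X_{\mathrm{III}}=\{x\in\mathcal T_\alpha:|x|\le-\lambda+R_3(x)\}$, $\mathcal X_{\mathrm{IV}}=\{x\in\mathcal T_\alpha:-x\in\mathcal X_{\mathrm{II}}\}$. *)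

theory Defs
  imports "HOL-Probability.Probability"
begin

definition dens_class :: "(real \<Rightarrow> real) set" where
  "dens_class = {g. (\<forall>x. 0 < g x) \<and> continuous_on UNIV g \<and>
     (\<integral>\<^sup>+ x. ennreal (g x) \<partial>lborel) = 1 \<and>
     (\<forall>x. g (- x) = g x) \<and> strict_antimono_on {0..} g}"

definition noise :: "(real \<Rightarrow> real) \<Rightarrow> real measure" where
  "noise g = density lborel (\<lambda>x. ennreal (g x))"

definition G :: "(real \<Rightarrow> real) \<Rightarrow> real \<Rightarrow> real" where
  "G g = cdf (noise g)"

definition Ginv :: "(real \<Rightarrow> real) \<Rightarrow> real \<Rightarrow> ereal" where
  "Ginv g p = (if p \<le> 0 then -\<infinity> else if 1 \<le> p then \<infinity> else ereal (inv (G g) p))"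

definition Delta :: "(real \<Rightarrow> real) \<Rightarrow> real \<Rightarrow> real \<Rightarrow> real" where
  "Delta g lam x = G g (lam - x) - G g (- lam - x)"

text \<open>The prior is an infinite measure for positive \<open>w\<close>; the posterior is its Bayes update under
  the likelihood \<open>\<theta> \<mapsto> g (x - \<theta>)\<close>, so the improper prior's proportionality constant is immaterial.\<close>

definition prior :: "real \<Rightarrow> real \<Rightarrow> real measure" where
  "prior w lam = measure_of UNIV (sets borel)
     (\<lambda>B. ennreal (1 - w) * indicator B 0 + ennreal w * emeasure lborel (B \<inter> {\<theta>. lam < \<bar>\<theta>\<bar>}))"

definition posterior :: "(real \<Rightarrow> real) \<Rightarrow> real \<Rightarrow> real \<Rightarrow> real \<Rightarrow> real measure" where
  "posterior g w lam x = density (prior w lam)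
     (\<lambda>\<theta>. ennreal (g (x - \<theta>)) / (\<integral>\<^sup>+ \<eta>. ennreal (g (x - \<eta>)) \<partial>prior w lam))"

definition level_set :: "(real \<Rightarrow> real) \<Rightarrow> real \<Rightarrow> real \<Rightarrow> real \<Rightarrow> real set" where
  "level_set g lam x c = {\<theta>. lam \<le> \<bar>\<theta>\<bar> \<and> c \<le> g (x - \<theta>)}"

definition HPD :: "(real \<Rightarrow> real) \<Rightarrow> real \<Rightarrow> real \<Rightarrow> real \<Rightarrow> real \<Rightarrow> real set" where
  "HPD g \<alpha> w lam x =
     (if 1 - \<alpha> \<le> measure (posterior g w lam x) {0} then {0}
      else (if w = 1 then {} else {0}) \<union>
        level_set g lam x
          (SOME c. measure (posterior g w lam x) (level_set g lam x c)
                   = 1 - \<alpha> - measure (posterior g w lam x) {0}))"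

text \<open>The conjunct \<open>w \<noteq> 1\<close> keeps the convention \<open>w / 0 = 0\<close> out of play: for \<open>w = 1\<close> the threshold is
  \<open>-\<infinity>\<close>. The left-hand side is strictly increasing on the nonnegative reals, so \<open>THE\<close> below is
  well defined whenever a solution exists.\<close>

definition t_eq :: "(real \<Rightarrow> real) \<Rightarrow> real \<Rightarrow> real \<Rightarrow> real \<Rightarrow> real \<Rightarrow> bool" where
  "t_eq g \<alpha> w lam t \<longleftrightarrow> w \<noteq> 1 \<and> 0 \<le> t \<and>
     w / (1 - w) * ((G g (t - lam) + G g (- t - lam)) / g t) = \<alpha> / (1 - \<alpha>)"

definition t_alpha :: "(real \<Rightarrow> real) \<Rightarrow> real \<Rightarrow> real \<Rightarrow> real \<Rightarrow> ereal" where
  "t_alpha g \<alpha> w lam =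
     (if \<exists>t. t_eq g \<alpha> w lam t then ereal (THE t. t_eq g \<alpha> w lam t) else -\<infinity>)"

definition R1 :: "(real \<Rightarrow> real) \<Rightarrow> real \<Rightarrow> real \<Rightarrow> real \<Rightarrow> real \<Rightarrow> ereal" where
  "R1 g \<alpha> w lam x =
     Ginv g (1 - \<alpha> / 2 - (1 - w) / (2 * w) * \<alpha> * g x - (1 - \<alpha>) / 2 * Delta g lam x)"

definition R2 :: "(real \<Rightarrow> real) \<Rightarrow> real \<Rightarrow> real \<Rightarrow> real \<Rightarrow> real \<Rightarrow> ereal" where
  "R2 g \<alpha> w lam x =
     Ginv g (1 - \<alpha> - (1 - w) / w * \<alpha> * g x + \<alpha> * Delta g lam x + G g (- lam - x))"

definition R3 :: "(real \<Rightarrow> real) \<Rightarrow> real \<Rightarrow> real \<Rightarrow> real \<Rightarrow> real \<Rightarrow> ereal" where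
  "R3 g \<alpha> w lam x =
     Ginv g (1 - \<alpha> / 2 - (1 - w) / (2 * w) * \<alpha> * g x + \<alpha> / 2 * Delta g lam x)"

definition T_set :: "(real \<Rightarrow> real) \<Rightarrow> real \<Rightarrow> real \<Rightarrow> real \<Rightarrow> real set" where
  "T_set g \<alpha> w lam = {x. t_alpha g \<alpha> w lam < ereal \<bar>x\<bar>}"

definition X_I :: "(real \<Rightarrow> real) \<Rightarrow> real \<Rightarrow> real \<Rightarrow> real \<Rightarrow> real set" where
  "X_I g \<alpha> w lam = {x \<in> T_set g \<alpha> w lam. ereal lam + R1 g \<alpha> w lam x < ereal \<bar>x\<bar>}"

definition X_II :: "(real \<Rightarrow> real) \<Rightarrow> real \<Rightarrow> real \<Rightarrow> real \<Rightarrow> real set" where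
  "X_II g \<alpha> w lam = {x \<in> T_set g \<alpha> w lam.
     ereal (- lam) + R3 g \<alpha> w lam x < ereal x \<and> ereal x \<le> ereal lam + R1 g \<alpha> w lam x}"

definition X_III :: "(real \<Rightarrow> real) \<Rightarrow> real \<Rightarrow> real \<Rightarrow> real \<Rightarrow> real set" where
  "X_III g \<alpha> w lam = {x \<in> T_set g \<alpha> w lam. ereal \<bar>x\<bar> \<le> ereal (- lam) + R3 g \<alpha> w lam x}"

definition X_IV :: "(real \<Rightarrow> real) \<Rightarrow> real \<Rightarrow> real \<Rightarrow> real \<Rightarrow> real set" where
  "X_IV g \<alpha> w lam = {x \<in> T_set g \<alpha> w lam. - x \<in> X_II g \<alpha> w lam}"

text \<open>The endpoints are \<open>ereal\<close>-valued because \<open>Ginv\<close> is, and are meaningful only on \<open>T_set\<close>,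
  which the four regimes partition.\<close>

definition U :: "(real \<Rightarrow> real) \<Rightarrow> real \<Rightarrow> real \<Rightarrow> real \<Rightarrow> real \<Rightarrow> ereal" where
  "U g \<alpha> w lam x =
     (if x \<in> X_I g \<alpha> w lam then ereal x + R1 g \<alpha> w lam x
      else if x \<in> X_II g \<alpha> w lam then ereal x + R2 g \<alpha> w lam x
      else if x \<in> X_III g \<alpha> w lam then ereal x + R3 g \<alpha> w lam x
      else if x \<in> X_IV g \<alpha> w lam then ereal (- lam)
      else undefined)"

definition L :: "(real \<Rightarrow> real) \<Rightarrow> real \<Rightarrow> real \<Rightarrow> real \<Rightarrow> real \<Rightarrow> ereal" where
  "L g \<alpha> w lam x = - U g \<alpha> w lam (- x)"

text \<open>Closed form of the posterior: an atom at zero plus a Lebesgue density.\<close>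

lemma sets_prior [simp, measurable_cong]: "sets (prior w lam) = sets borel"
  unfolding prior_def using sets.sigma_sets_eq[of "borel :: real measure"]
  by (simp add: sets_measure_of_conv)

lemma space_prior [simp]: "space (prior w lam) = UNIV"
  by (simp add: prior_def space_measure_of_conv)

lemma emeasure_prior:
  assumes "B \<in> sets borel"
  shows "emeasure (prior w lam) B =
    ennreal (1 - w) * indicator B 0 + ennreal w * emeasure lborel (B \<inter> {\<theta>. lam < \<bar>\<theta>\<bar>})"
proof (rule emeasure_measure_of[OF prior_def])
  let ?S = "{\<theta>::real. lam < \<bar>\<theta>\<bar>}"
  have S: "?S \<in> sets borel" by measurable
  show "B \<in> sets (prior w lam)" using assms by simp
  show "countably_additive (sets (prior w lam))
     (\<lambda>B. ennreal (1 - w) * indicator B 0 + ennreal w * emeasure lborel (B \<inter> ?S))"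
  proof (rule countably_additiveI)
    fix A :: "nat \<Rightarrow> real set"
    assume A: "range A \<subseteq> sets (prior w lam)" and d: "disjoint_family A"
    have m: "range (\<lambda>i. A i \<inter> ?S) \<subseteq> sets lborel" using A S by auto
    have d': "disjoint_family (\<lambda>i. A i \<inter> ?S)" using d by (auto simp: disjoint_family_on_def)
    have 1: "(\<Sum>i. emeasure lborel (A i \<inter> ?S)) = emeasure lborel ((\<Union>i. A i) \<inter> ?S)"
      unfolding suminf_emeasure[OF m d'] by (rule arg_cong[where f = "emeasure lborel"]) auto
    have 2: "(\<Sum>i. indicator (A i) 0) = (indicator (\<Union>i. A i) 0 :: ennreal)"
      using d by (rule suminf_indicator)
    show "(\<Sum>i. ennreal (1 - w) * indicator (A i) 0 + ennreal w * emeasure lborel (A i \<inter> ?S)) =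
      ennreal (1 - w) * indicator (\<Union>i. A i) 0 + ennreal w * emeasure lborel ((\<Union>i. A i) \<inter> ?S)"
      unfolding suminf_add[OF summableI summableI, symmetric] ennreal_suminf_cmult 1 2 ..
  qed
qed (auto simp: positive_def)

lemma nn_integral_prior:
  assumes "f \<in> borel_measurable borel"
  shows "(\<integral>\<^sup>+ \<theta>. f \<theta> \<partial>prior w lam) =
    ennreal (1 - w) * f 0 + ennreal w * (\<integral>\<^sup>+ \<theta>. f \<theta> * indicator {\<theta>. lam < \<bar>\<theta>\<bar>} \<theta> \<partial>lborel)"
  using assms
proof (induction rule: borel_measurable_induct)
  case (cong f g)
  then have "f = g" by auto
  with cong show ?case by simp
next
  case (set A)
  have "(\<integral>\<^sup>+ \<theta>. indicator A \<theta> * indicator {\<theta>. lam < \<bar>\<theta>\<bar>} \<theta> \<partial>lborel)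
      = (\<integral>\<^sup>+ \<theta>. indicator (A \<inter> {\<theta>. lam < \<bar>\<theta>\<bar>}) \<theta> \<partial>lborel)"
    by (simp add: indicator_inter_arith)
  also have "\<dots> = emeasure lborel (A \<inter> {\<theta>. lam < \<bar>\<theta>\<bar>})"
    using set by (intro nn_integral_indicator) auto
  finally show ?case using set by (simp add: emeasure_prior)
next
  case (mult u c)
  note [measurable] = mult.hyps(2)
  have "(\<integral>\<^sup>+ \<theta>. c * u \<theta> \<partial>prior w lam) = c * (\<integral>\<^sup>+ \<theta>. u \<theta> \<partial>prior w lam)"
    by (rule nn_integral_cmult) measurable
  moreover have "(\<integral>\<^sup>+ \<theta>. c * u \<theta> * indicator {\<theta>. lam < \<bar>\<theta>\<bar>} \<theta> \<partial>lborel)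
     = c * (\<integral>\<^sup>+ \<theta>. u \<theta> * indicator {\<theta>. lam < \<bar>\<theta>\<bar>} \<theta> \<partial>lborel)"
    unfolding mult.assoc by (rule nn_integral_cmult) measurable
  ultimately show ?case unfolding mult.IH by (simp only: distrib_left mult_ac)
next
  case (add u v)
  note [measurable] = add.hyps(1,3)
  have "(\<integral>\<^sup>+ \<theta>. v \<theta> + u \<theta> \<partial>prior w lam) = (\<integral>\<^sup>+ \<theta>. v \<theta> \<partial>prior w lam) + (\<integral>\<^sup>+ \<theta>. u \<theta> \<partial>prior w lam)"
    by (rule nn_integral_add) measurable
  moreover have "(\<integral>\<^sup>+ \<theta>. (v \<theta> + u \<theta>) * indicator {\<theta>. lam < \<bar>\<theta>\<bar>} \<theta> \<partial>lborel)
     = (\<integral>\<^sup>+ \<theta>. v \<theta> * indicator {\<theta>. lam < \<bar>\<theta>\<bar>} \<theta> \<partial>lborel)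
     + (\<integral>\<^sup>+ \<theta>. u \<theta> * indicator {\<theta>. lam < \<bar>\<theta>\<bar>} \<theta> \<partial>lborel)"
    unfolding distrib_right by (rule nn_integral_add) measurable
  ultimately show ?case unfolding add.IH by (simp only: distrib_left add_ac)
next
  case (seq F)
  note [measurable] = seq.hyps(1)
  have S: "{\<theta>::real. lam < \<bar>\<theta>\<bar>} \<in> sets borel" by measurable
  have inc: "incseq (\<lambda>i \<theta>. F i \<theta> * indicator {\<theta>. lam < \<bar>\<theta>\<bar>} \<theta>)"
    using seq.hyps(3) by (auto simp: incseq_def le_fun_def intro!: mult_right_mono)
  have i0: "incseq (\<lambda>i. F i 0)" using seq.hyps(3) by (auto simp: incseq_def le_fun_def)
  have i1: "incseq (\<lambda>i. \<integral>\<^sup>+ \<theta>. F i \<theta> * indicator {\<theta>. lam < \<bar>\<theta>\<bar>} \<theta> \<partial>lborel)"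
    using inc by (auto simp: incseq_def le_fun_def intro!: nn_integral_mono)
  have L: "(\<integral>\<^sup>+ \<theta>. (SUP i. F i \<theta>) \<partial>prior w lam) = (SUP i. \<integral>\<^sup>+ \<theta>. F i \<theta> \<partial>prior w lam)"
    by (rule nn_integral_monotone_convergence_SUP[OF seq.hyps(3)]) measurable
  have R: "(\<integral>\<^sup>+ \<theta>. (SUP i. F i \<theta>) * indicator {\<theta>. lam < \<bar>\<theta>\<bar>} \<theta> \<partial>lborel)
      = (SUP i. \<integral>\<^sup>+ \<theta>. F i \<theta> * indicator {\<theta>. lam < \<bar>\<theta>\<bar>} \<theta> \<partial>lborel)"
    unfolding SUP_mult_right_ennreal
    by (rule nn_integral_monotone_convergence_SUP[OF inc]) measurable
  have i0': "incseq (\<lambda>i. ennreal (1 - w) * F i 0)"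
    using i0 by (auto simp: incseq_def intro!: mult_left_mono)
  have i1': "incseq (\<lambda>i. ennreal w * (\<integral>\<^sup>+ \<theta>. F i \<theta> * indicator {\<theta>. lam < \<bar>\<theta>\<bar>} \<theta> \<partial>lborel))"
    using i1 by (auto simp: incseq_def intro!: mult_left_mono)
  show ?case
    unfolding SUP_apply L R seq.IH SUP_mult_left_ennreal
    by (rule ennreal_SUP_add[OF i0' i1'])
qed

lemma prob_space_noise:
  assumes "g \<in> dens_class" shows "prob_space (noise g)"
proof
  have "g \<in> borel_measurable borel"
    using assms by (auto simp: dens_class_def intro: borel_measurable_continuous_onI)
  then show "emeasure (noise g) (space (noise g)) = 1"
    using assms by (simp add: noise_def dens_class_def emeasure_density)
qed

lemma nn_integral_likelihood:
  assumes g: "g \<in> dens_class" and lam: "0 < lam"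
  shows "(\<integral>\<^sup>+ \<theta>. ennreal (g (x - \<theta>)) * indicator {\<theta>. lam < \<bar>\<theta>\<bar>} \<theta> \<partial>lborel)
    = ennreal (1 - Delta g lam x)"
proof -
  interpret prob_space "noise g" using g by (rule prob_space_noise)
  interpret real_distribution "noise g"
    by unfold_locales (simp_all add: noise_def)
  have [measurable]: "g \<in> borel_measurable borel"
    using g by (auto simp: dens_class_def intro: borel_measurable_continuous_onI)
  have sym: "g (x - \<theta>) = g (\<theta> - x)" for \<theta>
    using g by (metis (mono_tags, lifting) dens_class_def mem_Collect_eq minus_diff_eq)
  have "(\<integral>\<^sup>+ \<theta>. ennreal (g (x - \<theta>)) * indicator {\<theta>. lam < \<bar>\<theta>\<bar>} \<theta> \<partial>lborel)
     = (\<integral>\<^sup>+ \<theta>. ennreal (g (\<theta> - x)) * indicator {\<theta>. lam < \<bar>\<theta>\<bar>} \<theta> \<partial>lborel)"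
    by (simp add: sym)
  also have "\<dots> = (\<integral>\<^sup>+ u. ennreal (g u) * indicator {u. lam < \<bar>x + u\<bar>} u \<partial>lborel)"
    by (subst nn_integral_real_affine[where c = 1 and t = x])
       (auto simp: indicator_def intro!: nn_integral_cong)
  also have "\<dots> = emeasure (noise g) {u. lam < \<bar>x + u\<bar>}"
    unfolding noise_def by (subst emeasure_density) auto
  also have "\<dots> = ennreal (measure (noise g) {u. lam < \<bar>x + u\<bar>})"
    by (rule emeasure_eq_measure)
  also have "measure (noise g) {u. lam < \<bar>x + u\<bar>} = 1 - Delta g lam x"
  proof -
    have at: "measure (noise g) {a} = 0" for a
    proof -
      have "emeasure (noise g) {a} = 0"
        unfolding noise_def by (subst emeasure_density) (auto simp: nn_integral_0_iff_AE AE_lborel_singleton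
          intro!: AE_I[of _ _ "{a}"])
      then show ?thesis by (simp add: measure_def)
    qed
    have "measure (noise g) {- lam - x<..lam - x} = Delta g lam x"
      using lam cdf_diff_eq[of "- lam - x" "lam - x"] by (simp add: Delta_def G_def)
    moreover have "{- lam - x..lam - x} = {- lam - x} \<union> {- lam - x<..lam - x}"
      using lam by auto
    then have "measure (noise g) {- lam - x..lam - x}
       = measure (noise g) {- lam - x} + measure (noise g) {- lam - x<..lam - x}"
      by (simp only:) (rule finite_measure_Union, auto)
    ultimately have "measure (noise g) {- lam - x..lam - x} = Delta g lam x" by (simp add: at)
    moreover have "{u. lam < \<bar>x + u\<bar>} = space (noise g) - {- lam - x..lam - x}"
      by (auto simp: noise_def)
    ultimately show ?thesis using prob_compl[of "{- lam - x..lam - x}"] by simp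
  qed
  finally show ?thesis .
qed

lemma Delta_less_1:
  assumes "g \<in> dens_class"
  shows "Delta g lam x < 1"
proof -
  interpret prob_space "noise g" using assms by (rule prob_space_noise)
  interpret real_distribution "noise g"
    by unfold_locales (simp_all add: noise_def)
  have [measurable]: "g \<in> borel_measurable borel"
    using assms by (auto simp: dens_class_def intro: borel_measurable_continuous_onI)
  have "emeasure (noise g) {.. - lam - x} \<noteq> 0"
  proof
    assume "emeasure (noise g) {.. - lam - x} = 0"
    then have "AE u in lborel. ennreal (g u) * indicator {.. - lam - x} u = 0"
      unfolding noise_def by (subst (asm) emeasure_density) (auto simp: nn_integral_0_iff_AE)
    moreover have "0 < g u" for u using assms by (simp add: dens_class_def)
    ultimately have "AE u in lborel. u \<notin> {.. - lam - x}"
      by (auto simp: indicator_def ennreal_eq_0_iff not_le[symmetric] elim!: eventually_mono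
          split: if_splits)
    then have "{.. - lam - x} \<in> null_sets lborel"
      by (subst AE_iff_null_sets) auto
    then have "{- lam - x - 1 .. - lam - x} \<in> null_sets lborel"
      by (rule null_sets_subset) auto
    then show False by (auto simp: null_sets_def)
  qed
  then have "0 < G g (- lam - x)"
    by (simp add: G_def cdf_def emeasure_eq_measure zero_less_measure_iff)
  moreover have "G g (lam - x) \<le> 1" by (simp add: G_def cdf_bounded_prob)
  ultimately show ?thesis by (simp add: Delta_def)
qed

lemma emeasure_posterior:
  assumes g: "g \<in> dens_class" and w: "0 < w" "w \<le> 1" and lam: "0 < lam"
    and B: "B \<in> sets borel"
  shows "emeasure (posterior g w lam x) B =
    ennreal ((1 - w) * g x / ((1 - w) * g x + w * (1 - Delta g lam x))) * indicator B 0 +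
    (\<integral>\<^sup>+ \<theta>\<in>B. ennreal (w * g (x - \<theta>) * indicator {\<theta>. lam < \<bar>\<theta>\<bar>} \<theta>
              / ((1 - w) * g x + w * (1 - Delta g lam x))) \<partial>lborel)"
proof -
  have [measurable]: "g \<in> borel_measurable borel"
    using g by (auto simp: dens_class_def intro: borel_measurable_continuous_onI)
  note [measurable] = B
  have pos: "0 < g u" for u using g by (simp add: dens_class_def)
  define D where "D = (1 - w) * g x + w * (1 - Delta g lam x)"
  have D: "0 < D"
    unfolding D_def using w pos[of x] Delta_less_1[OF g, of lam x]
    by (intro add_nonneg_pos mult_nonneg_nonneg mult_pos_pos) auto
  have ev: "(\<integral>\<^sup>+ \<eta>. ennreal (g (x - \<eta>)) \<partial>prior w lam) = ennreal D"
    using w pos[of x] Delta_less_1[OF g, of lam x]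
    by (subst nn_integral_prior)
       (auto simp: nn_integral_likelihood[OF g lam] D_def ennreal_mult' ennreal_plus less_imp_le)
  have div: "ennreal (g u) / ennreal D = ennreal (g u / D)" for u
    using D pos[of u] by (simp add: divide_ennreal)
  have "emeasure (posterior g w lam x) B
     = (\<integral>\<^sup>+ \<theta>. ennreal (g (x - \<theta>) / D) * indicator B \<theta> \<partial>prior w lam)"
    unfolding posterior_def ev div by (rule emeasure_density) auto
  also have "\<dots> = ennreal (1 - w) * (ennreal (g x / D) * indicator B 0) +
     ennreal w * (\<integral>\<^sup>+ \<theta>. ennreal (g (x - \<theta>) / D) * indicator B \<theta> * indicator {\<theta>. lam < \<bar>\<theta>\<bar>} \<theta> \<partial>lborel)"
    by (subst nn_integral_prior) auto
  also have "ennreal w * (\<integral>\<^sup>+ \<theta>. ennreal (g (x - \<theta>) / D) * indicator B \<theta> * indicator {\<theta>. lam < \<bar>\<theta>\<bar>} \<theta> \<partial>lborel)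
     = (\<integral>\<^sup>+ \<theta>. ennreal w * (ennreal (g (x - \<theta>) / D) * indicator B \<theta> * indicator {\<theta>. lam < \<bar>\<theta>\<bar>} \<theta>) \<partial>lborel)"
    by (rule nn_integral_cmult[symmetric]) measurable
  also have "\<dots> = (\<integral>\<^sup>+ \<theta>\<in>B. ennreal (w * g (x - \<theta>) * indicator {\<theta>. lam < \<bar>\<theta>\<bar>} \<theta> / D) \<partial>lborel)"
    using w by (intro nn_integral_cong) (auto simp: indicator_def ennreal_mult'[symmetric])
  also have "ennreal (1 - w) * (ennreal (g x / D) * indicator B 0)
     = ennreal ((1 - w) * g x / D) * indicator B 0"
    using w by (auto simp: indicator_def ennreal_mult'[symmetric])
  finally show ?thesis unfolding D_def .
qed

end

theory Submission
  imports Defs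
begin

text \<open>
  Apart from its atom at zero, the posterior given \<open>X = x\<close> is, up to the constant
  \<open>w / evidence x\<close>, the law of \<open>x + \<epsilon>\<close> with the gap \<open>(- lam, lam)\<close> removed. As \<open>g\<close> is symmetric and
  unimodal, its level sets are the balls around \<open>x\<close> with the gap removed, so the credible set is
  determined by a single radius \<open>r\<close>. Measured on the scale of the noise, the mass that remains to be
  covered after the atom has been counted is
  \<open>slab_mass x = (1 - \<alpha>) * (1 - Delta g lam x) - (1 - w) / w * \<alpha> * g x\<close>, and two questions
  remain.

  When is it positive? That is exactly the condition under which the atom alone does not suffice.
  For \<open>w < 1\<close>, \<open>slab_mass\<close> is continuous, strictly increasing in \<open>\<bar>x\<bar>\<close> and eventually nonnegative, and
  the equation defining \<open>t_alpha\<close> says that it vanishes; so its sign is decided by comparing \<open>\<bar>x\<bar>\<close> with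
  \<open>t_alpha\<close> (\<open>slab_mass_nonpos_iff_t_alpha\<close>).

  Which radius gives the mass \<open>slab_mass x\<close>? Let \<open>G\<close> be the distribution function of the noise. If
  the ball misses the gap, its mass is \<open>2 * G r - 1\<close>. If it contains the gap, its mass is
  \<open>2 * G r - 1 - Delta\<close>. If it contains \<open>lam\<close> but not \<open>- lam\<close>, what is left of it is
  \<open>[lam, x + r]\<close>, with mass \<open>G r - G (lam - x)\<close>; the mirror image of this is the fourth case.
  Solving for \<open>r\<close> gives \<open>R1\<close>, \<open>R3\<close> and \<open>R2\<close>, and, since \<open>G\<close> is strictly increasing, the regimes are
  inequalities between values of \<open>G\<close> that say which of the configurations occurs.

  Finally, a ball has no mass as long as it stays inside the gap, and from the moment it reaches beyond
  it keeps gaining mass on the side of \<open>x\<close> that faces away from zero. A positive mass therefore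
  determines the level set (\<open>level_set_eqI_measure\<close>), and it suffices to exhibit one radius with the
  right mass (\<open>HPD_eqI\<close>).
\<close>

section \<open>The noise distribution\<close>

locale unimodal_noise =
  fixes g :: "real \<Rightarrow> real"
  assumes g: "g \<in> dens_class"
begin

lemma g_pos: "0 < g u"
  using g by (simp add: dens_class_def)

lemma g_minus: "g (- u) = g u"
  using g by (simp add: dens_class_def)

lemma g_abs: "g \<bar>u\<bar> = g u"
  by (simp add: abs_if g_minus)

lemma g_diff_commute: "g (u - v) = g (v - u)"
  using g_minus[of "v - u"] by simp

lemma continuous_on_g: "continuous_on A g"
  using g by (auto simp: dens_class_def intro: continuous_on_subset)

lemma measurable_g [measurable]: "g \<in> borel_measurable borel"
  by (rule borel_measurable_continuous_onI[OF continuous_on_g])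

lemma g_less_iff: "g u < g v \<longleftrightarrow> \<bar>v\<bar> < \<bar>u\<bar>"
proof -
  have anti: "g b < g a" if "0 \<le> a" "a < b" for a b
    using g that by (auto simp: dens_class_def monotone_on_def)
  have "g \<bar>u\<bar> < g \<bar>v\<bar> \<longleftrightarrow> \<bar>v\<bar> < \<bar>u\<bar>"
    using anti[of "\<bar>u\<bar>" "\<bar>v\<bar>"] anti[of "\<bar>v\<bar>" "\<bar>u\<bar>"]
    by (cases "\<bar>u\<bar>" "\<bar>v\<bar>" rule: linorder_cases) auto
  then show ?thesis by (simp add: g_abs)
qed

lemma g_le_iff: "g u \<le> g v \<longleftrightarrow> \<bar>v\<bar> \<le> \<bar>u\<bar>"
  using g_less_iff[of v u] by (simp add: not_less[symmetric])

sublocale noise: real_distribution "noise g"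
proof -
  interpret prob_space "noise g" using g by (rule prob_space_noise)
  show "real_distribution (noise g)"
    by unfold_locales (simp_all add: noise_def)
qed

lemma emeasure_noise:
  "A \<in> sets borel \<Longrightarrow> emeasure (noise g) A = (\<integral>\<^sup>+ u. ennreal (g u) * indicator A u \<partial>lborel)"
  unfolding noise_def by (rule emeasure_density) auto

text \<open>Masses of translated intervals are integrals over one common interval, so that they can be
  compared pointwise and matched with the posterior density \<open>\<theta> \<mapsto> g (\<theta> - x)\<close>.\<close>

lemma emeasure_noise_shift:
  "emeasure (noise g) {a - d..b - d} = (\<integral>\<^sup>+ u. ennreal (g (u - d)) * indicator {a..b} u \<partial>lborel)"
  unfolding emeasure_noise[OF borel_closed[OF closed_atLeastAtMost]]
  by (subst nn_integral_real_affine[where c = 1 and t = "- d"])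
     (auto simp: indicator_def intro!: nn_integral_cong)

lemma measure_noise_singleton: "measure (noise g) {a} = 0"
proof -
  have "emeasure (noise g) {a} = (\<integral>\<^sup>+ u. ennreal (g a) * indicator {a} u \<partial>lborel)"
    by (auto simp: emeasure_noise indicator_def intro!: nn_integral_cong)
  also have "\<dots> = 0" by (simp add: nn_integral_cmult_indicator)
  finally show ?thesis by (simp add: measure_def)
qed

lemma isCont_G: "isCont (G g) a"
  unfolding G_def noise.isCont_cdf by (rule measure_noise_singleton)

lemma continuous_on_G: "continuous_on A (G g)"
  by (simp add: continuous_at_imp_continuous_on isCont_G)

lemma measure_noise_Icc:
  assumes "a \<le> b"
  shows "measure (noise g) {a..b} = G g b - G g a"
proof (cases "a = b")
  case False
  then have "a < b" using assms by simp
  moreover have "{a..b} = {a} \<union> {a<..b}" using assms by auto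
  then have "measure (noise g) {a..b} = measure (noise g) {a} + measure (noise g) {a<..b}"
    by (simp only:) (rule noise.finite_measure_Union, auto)
  ultimately show ?thesis
    by (simp add: measure_noise_singleton noise.cdf_diff_eq G_def)
qed (simp add: measure_noise_singleton)

lemma emeasure_noise_Icc:
  "a \<le> b \<Longrightarrow> emeasure (noise g) {a..b} = ennreal (G g b - G g a)"
  by (simp add: noise.emeasure_eq_measure measure_noise_Icc)

lemma G_strict_mono: "strict_mono (G g)"
proof (rule strict_monoI)
  fix a b :: real assume ab: "a < b"
  \<comment> \<open>On a bounded interval the density is bounded below by its value at the endpoint of larger modulus.\<close>
  define m where "m = g (max \<bar>a\<bar> \<bar>b\<bar>)"
  have "0 < ennreal (m * (b - a))" using ab by (simp add: m_def g_pos)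
  also have "\<dots> = (\<integral>\<^sup>+ u. ennreal m * indicator {a..b} u \<partial>lborel)"
    using ab by (simp add: nn_integral_cmult_indicator m_def g_pos ennreal_mult' less_imp_le)
  also have "\<dots> \<le> (\<integral>\<^sup>+ u. ennreal (g u) * indicator {a..b} u \<partial>lborel)"
    by (intro nn_integral_mono) (auto simp: indicator_def m_def g_le_iff intro!: ennreal_leI)
  also have "\<dots> = ennreal (G g b - G g a)"
    using ab by (simp flip: emeasure_noise add: emeasure_noise_Icc)
  finally show "G g a < G g b" by simp
qed

lemma G_less_iff: "G g a < G g b \<longleftrightarrow> a < b"
  using G_strict_mono by (rule strict_mono_less)

lemma G_le_iff: "G g a \<le> G g b \<longleftrightarrow> a \<le> b"
  using G_strict_mono by (rule strict_mono_less_eq)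

text \<open>Reflection maps the left tail to the right tail, whose mass is one minus \<open>G\<close> in the absence of
  atoms.\<close>

lemma G_minus: "G g (- z) = 1 - G g z"
proof -
  have "emeasure (noise g) {..- z} = emeasure (noise g) {z..}"
    unfolding emeasure_noise[OF borel_closed[OF closed_atMost]]
      emeasure_noise[OF borel_closed[OF closed_atLeast]]
    by (subst nn_integral_real_affine[where c = "-1" and t = 0])
       (auto simp: indicator_def g_minus intro!: nn_integral_cong)
  then have "G g (- z) = measure (noise g) {z..}"
    by (simp add: G_def cdf_def measure_def)
  also have "{z..} = insert z (space (noise g) - {..z})" by auto
  also have "measure (noise g) \<dots> = measure (noise g) {z} + measure (noise g) (space (noise g) - {..z})"
    by (subst noise.finite_measure_Union[symmetric]) auto
  also have "\<dots> = 1 - G g z"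
    by (subst noise.prob_compl) (auto simp: measure_noise_singleton G_def cdf_def)
  finally show ?thesis .
qed

lemma G_0: "G g 0 = 1 / 2"
  using G_minus[of 0] by simp

lemma G_pos: "0 < G g z"
proof -
  have "0 \<le> G g (z - 1)" by (simp add: G_def cdf_def)
  also have "\<dots> < G g z" by (simp add: G_less_iff)
  finally show ?thesis .
qed

lemma G_less_1: "G g z < 1"
  using G_pos[of "- z"] by (simp add: G_minus)

lemma G_surj:
  assumes "0 < p" "p < 1"
  shows "\<exists>r. G g r = p"
proof -
  have "eventually (\<lambda>r. G g r < p) at_bot"
    using order_tendstoD(2)[OF noise.cdf_lim_at_bot assms(1)] by (simp add: G_def)
  then obtain a where a: "G g a < p" by (auto simp: eventually_at_bot_linorder)
  have "eventually (\<lambda>r. p < G g r) at_top"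
    using order_tendstoD(1)[OF noise.cdf_lim_at_top_prob assms(2)] by (simp add: G_def)
  then obtain b where b: "p < G g b" by (auto simp: eventually_at_top_linorder)
  have "G g a < G g b" using a b by simp
  then have "a \<le> b" by (simp add: G_less_iff)
  then show ?thesis using IVT'[of "G g" a p b] a b continuous_on_G by auto
qed

text \<open>Strictly between zero and one the extended quantile function has a real value at which \<open>G\<close> takes
  the prescribed level, so equations between quantiles can be checked after applying \<open>G\<close>.\<close>

lemma GinvE:
  assumes "0 < p" "p < 1"
  obtains r where "Ginv g p = ereal r" "G g r = p"
proof -
  obtain r where r: "G g r = p" using G_surj[OF assms] by blast
  have "inv (G g) p = r"
    unfolding r[symmetric] by (rule inv_f_f[OF strict_mono_imp_inj_on[OF G_strict_mono]])
  then show ?thesis using assms r by (intro that) (simp_all add: Ginv_def)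
qed

text \<open>A density decreasing on the positive half-line lies above its value at \<open>t\<close> on all of \<open>[0, t]\<close>,
  which bounds it by the reciprocal and forces it to vanish at infinity.\<close>

lemma g_le_inverse:
  assumes "0 < t"
  shows "t * g t \<le> 1"
proof -
  have "ennreal (t * g t) = (\<integral>\<^sup>+ u. ennreal (g t) * indicator {0..t} u \<partial>lborel)"
    using assms by (simp add: nn_integral_cmult_indicator g_pos ennreal_mult' less_imp_le mult.commute)
  also have "\<dots> \<le> (\<integral>\<^sup>+ u. ennreal (g u) * indicator {0..t} u \<partial>lborel)"
    using assms by (intro nn_integral_mono) (auto simp: indicator_def g_le_iff intro!: ennreal_leI)
  also have "\<dots> = emeasure (noise g) {0..t}" by (simp add: emeasure_noise)
  also have "\<dots> \<le> 1" by (rule noise.measure_le_1)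
  finally show ?thesis by simp
qed

end

section \<open>The posterior and its level sets\<close>

locale theta_min_model = unimodal_noise +
  fixes w lam :: real
  assumes w: "0 < w" "w \<le> 1" and lam: "0 < lam"
begin

lemma Delta_alt: "Delta g lam x = G g (x + lam) - G g (x - lam)"
  using G_minus[of "x + lam"] G_minus[of "x - lam"] by (simp add: Delta_def algebra_simps)

lemma Delta_minus: "Delta g lam (- x) = Delta g lam x"
  by (simp add: Delta_alt[of x]) (simp add: Delta_def algebra_simps)

lemma Delta_pos: "0 < Delta g lam x"
  using lam by (simp add: Delta_def G_less_iff)

text \<open>As \<open>s\<close> moves away from zero, the window \<open>[s - lam, s + lam]\<close> gains density \<open>g (s + lam)\<close> at its far
  end and loses the larger density \<open>g (s - lam)\<close> at its near end.\<close>

lemma Delta_antimono: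
  assumes "0 \<le> s" "s < t"
  shows "Delta g lam t \<le> Delta g lam s"
proof -
  have "ennreal (G g (t + lam) - G g (s + lam))
      = (\<integral>\<^sup>+ u. ennreal (g (u + lam)) * indicator {s..t} u \<partial>lborel)"
    using emeasure_noise_shift[of s "- lam" t] assms by (simp add: emeasure_noise_Icc)
  also have "\<dots> \<le> (\<integral>\<^sup>+ u. ennreal (g (u - lam)) * indicator {s..t} u \<partial>lborel)"
    using assms lam by (intro nn_integral_mono) (auto simp: indicator_def g_le_iff intro!: ennreal_leI)
  also have "\<dots> = ennreal (G g (t - lam) - G g (s - lam))"
    using emeasure_noise_shift[of s lam t] assms by (simp add: emeasure_noise_Icc)
  finally have "G g (t + lam) - G g (s + lam) \<le> G g (t - lam) - G g (s - lam)"
    using assms by (subst (asm) ennreal_le_iff) (auto simp: G_le_iff)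
  then show ?thesis by (simp add: Delta_alt)
qed

definition evidence :: "real \<Rightarrow> real" where
  "evidence x = (1 - w) * g x + w * (1 - Delta g lam x)"

lemma evidence_pos: "0 < evidence x"
  unfolding evidence_def using w g_pos[of x] Delta_less_1[OF g, of lam x]
  by (intro add_nonneg_pos mult_nonneg_nonneg mult_pos_pos) auto

lemma sets_posterior [simp]: "sets (posterior g w lam x) = sets borel"
  by (simp add: posterior_def)

lemma space_posterior [simp]: "space (posterior g w lam x) = UNIV"
  by (simp add: posterior_def)

lemma posterior_finite: "finite_measure (posterior g w lam x)"
proof
  have "(\<integral>\<^sup>+ \<theta>. ennreal (w * g (x - \<theta>) * indicator {\<theta>. lam < \<bar>\<theta>\<bar>} \<theta> / evidence x) \<partial>lborel)
      = (\<integral>\<^sup>+ \<theta>. ennreal (w / evidence x) * (ennreal (g (x - \<theta>)) * indicator {\<theta>. lam < \<bar>\<theta>\<bar>} \<theta>) \<partial>lborel)"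
    using w evidence_pos[of x]
    by (intro nn_integral_cong) (auto simp: indicator_def ennreal_mult'[symmetric])
  also have "\<dots> = ennreal (w / evidence x) * ennreal (1 - Delta g lam x)"
    by (subst nn_integral_cmult) (auto simp: nn_integral_likelihood[OF g lam])
  finally show "emeasure (posterior g w lam x) (space (posterior g w lam x)) \<noteq> \<infinity>"
    by (simp add: emeasure_posterior[OF g w lam] evidence_def[symmetric] ennreal_mult_eq_top_iff)
qed

lemma measure_posterior_0:
  "measure (posterior g w lam x) {0} = (1 - w) * g x / evidence x"
proof -
  have "emeasure (posterior g w lam x) {0} = ennreal ((1 - w) * g x / evidence x)"
    using lam by (simp add: emeasure_posterior[OF g w lam] evidence_def nn_integral_null_set)
  then show ?thesis
    using w g_pos[of x] evidence_pos[of x] by (simp add: measure_def)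
qed

text \<open>The slab lives on \<open>lam < \<bar>\<theta>\<bar>\<close> whereas credible sets are closed; the two points \<open>- lam\<close> and \<open>lam\<close>
  that make the difference are Lebesgue-null.\<close>

lemma measure_posterior_Icc:
  assumes ab: "a \<le> b" and out: "\<And>\<theta>. a \<le> \<theta> \<Longrightarrow> \<theta> \<le> b \<Longrightarrow> lam \<le> \<bar>\<theta>\<bar>"
  shows "measure (posterior g w lam x) {a..b} = w / evidence x * (G g (b - x) - G g (a - x))"
proof -
  have zero: "0 \<notin> {a..b}" using out[of 0] lam by auto
  have "emeasure (posterior g w lam x) {a..b}
      = (\<integral>\<^sup>+ \<theta>. ennreal (w * g (x - \<theta>) * indicator {\<theta>. lam < \<bar>\<theta>\<bar>} \<theta> / evidence x) * indicator {a..b} \<theta> \<partial>lborel)"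
    using zero by (simp add: emeasure_posterior[OF g w lam] evidence_def)
  also have "\<dots> = (\<integral>\<^sup>+ \<theta>. ennreal (w / evidence x) * (ennreal (g (\<theta> - x)) * indicator {a..b} \<theta>) \<partial>lborel)"
  proof (rule nn_integral_cong_AE)
    have "AE \<theta> in lborel. \<theta> \<noteq> lam \<and> \<theta> \<noteq> - lam"
      using AE_lborel_singleton[of lam] AE_lborel_singleton[of "- lam"] by eventually_elim auto
    then show "AE \<theta> in lborel. ennreal (w * g (x - \<theta>) * indicator {\<theta>. lam < \<bar>\<theta>\<bar>} \<theta> / evidence x) * indicator {a..b} \<theta>
       = ennreal (w / evidence x) * (ennreal (g (\<theta> - x)) * indicator {a..b} \<theta>)"
    proof eventually_elim
      case (elim \<theta>)
      show ?case
      proof (cases "\<theta> \<in> {a..b}")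
        case True
        then have "lam < \<bar>\<theta>\<bar>" using out[of \<theta>] elim by auto
        then show ?thesis using True w evidence_pos[of x]
          by (simp add: ennreal_mult'[symmetric] g_diff_commute)
      qed simp
    qed
  qed
  also have "\<dots> = ennreal (w / evidence x) * emeasure (noise g) {a - x..b - x}"
    by (subst nn_integral_cmult) (auto simp: emeasure_noise_shift)
  also have "\<dots> = ennreal (w / evidence x * (G g (b - x) - G g (a - x)))"
    using ab w evidence_pos[of x] by (simp add: emeasure_noise_Icc ennreal_mult' del: times_divide_eq_left)
  finally show ?thesis
    using ab w evidence_pos[of x] by (simp add: measure_def G_le_iff)
qed

lemma level_set_borel [measurable]: "level_set g lam x c \<in> sets borel"
  unfolding level_set_def by measurable

lemma level_set_eq_Icc:
  assumes "0 \<le> r"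
  shows "level_set g lam x (g r) = {x - r..x + r} - {- lam<..<lam}"
  using assms by (auto simp: level_set_def g_le_iff)

text \<open>If the larger level set had a point \<open>\<theta>0\<close> that the smaller one lacks, then \<open>x\<close> is farther from
  \<open>\<theta>0\<close> than from some \<open>\<theta>1\<close> in the smaller set. Walking from \<open>x\<close> away from zero over distances
  between these two stays outside the gap, and a nondegenerate interval of this walk lies in the larger
  set only. Its positive mass contradicts the equality of masses. Positivity of the common mass is what
  supplies \<open>\<theta>1\<close>.\<close>

lemma level_set_eqI_measure_le:
  assumes le: "c \<le> c'"
    and eq: "measure (posterior g w lam x) (level_set g lam x c)
           = measure (posterior g w lam x) (level_set g lam x c')"
    and pos: "0 < measure (posterior g w lam x) (level_set g lam x c')"
  shows "level_set g lam x c = level_set g lam x c'"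
proof (rule ccontr)
  interpret post: finite_measure "posterior g w lam x" by (rule posterior_finite)
  assume neq: "level_set g lam x c \<noteq> level_set g lam x c'"
  have sub: "level_set g lam x c' \<subseteq> level_set g lam x c"
    using le by (auto simp: level_set_def)
  obtain \<theta>0 where "\<theta>0 \<in> level_set g lam x c" "\<theta>0 \<notin> level_set g lam x c'"
    using neq sub by blast
  then have \<theta>0: "c \<le> g \<bar>x - \<theta>0\<bar>" "g \<bar>x - \<theta>0\<bar> < c'" by (auto simp: level_set_def g_abs)
  have "level_set g lam x c' \<noteq> {}" using pos by auto
  then obtain \<theta>1 where \<theta>1: "lam \<le> \<bar>\<theta>1\<bar>" "c' \<le> g \<bar>x - \<theta>1\<bar>" by (auto simp: level_set_def g_abs)
  \<comment> \<open>A value of the density strictly between \<open>g \<bar>x - \<theta>0\<bar>\<close> and \<open>c'\<close> makes the walk start strictly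
    before the distance of \<open>\<theta>0\<close> and yet outside the smaller level set.\<close>
  define v where "v = (g \<bar>x - \<theta>0\<bar> + c') / 2"
  have v: "g \<bar>x - \<theta>0\<bar> < v" "v < c'" using \<theta>0 by (auto simp: v_def)
  have "g \<bar>x - \<theta>0\<bar> < g \<bar>x - \<theta>1\<bar>" using \<theta>0 \<theta>1 by simp
  then have "\<bar>x - \<theta>1\<bar> \<le> \<bar>x - \<theta>0\<bar>" by (simp add: g_less_iff)
  then obtain s where s: "\<bar>x - \<theta>1\<bar> \<le> s" "s \<le> \<bar>x - \<theta>0\<bar>" "g s = v"
    using IVT2'[of g "\<bar>x - \<theta>0\<bar>" v "\<bar>x - \<theta>1\<bar>"] v \<theta>1 continuous_on_g by force
  have s_less: "s < \<bar>x - \<theta>0\<bar>" using s v by (cases "s = \<bar>x - \<theta>0\<bar>") auto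
  \<comment> \<open>Walking away from zero over a distance of at least \<open>\<bar>x - \<theta>1\<bar>\<close> leads to a modulus of at least
    \<open>\<bar>x\<bar> + \<bar>x - \<theta>1\<bar>\<close>, hence at least \<open>\<bar>\<theta>1\<bar>\<close>, so it ends outside the gap.\<close>
  define a b where "a = (if 0 \<le> x then x + s else x - \<bar>x - \<theta>0\<bar>)"
    and "b = (if 0 \<le> x then x + \<bar>x - \<theta>0\<bar> else x - s)"
  have ab: "a < b" using s_less by (simp add: a_def b_def)
  have J: "lam \<le> \<bar>\<theta>\<bar> \<and> s \<le> \<bar>x - \<theta>\<bar> \<and> \<bar>x - \<theta>\<bar> \<le> \<bar>x - \<theta>0\<bar>" if "a \<le> \<theta>" "\<theta> \<le> b" for \<theta>
    using that s(1) \<theta>1(1) by (auto simp: a_def b_def split: if_splits)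
  have "{a..b} \<subseteq> level_set g lam x c - level_set g lam x c'"
  proof
    fix \<theta> assume "\<theta> \<in> {a..b}"
    then have *: "lam \<le> \<bar>\<theta>\<bar>" "s \<le> \<bar>x - \<theta>\<bar>" "\<bar>x - \<theta>\<bar> \<le> \<bar>x - \<theta>0\<bar>" using J by auto
    have "g \<bar>x - \<theta>0\<bar> \<le> g (x - \<theta>)" using * by (simp add: g_le_iff)
    moreover have "g (x - \<theta>) \<le> g s" using * s(1) by (simp add: g_le_iff)
    ultimately show "\<theta> \<in> level_set g lam x c - level_set g lam x c'"
      using * \<theta>0 s(3) v by (auto simp: level_set_def)
  qed
  then have "measure (posterior g w lam x) {a..b}
      \<le> measure (posterior g w lam x) (level_set g lam x c - level_set g lam x c')"
    by (intro post.finite_measure_mono) auto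
  also have "\<dots> = 0"
    using sub eq by (subst post.finite_measure_Diff) auto
  finally have "w / evidence x * (G g (b - x) - G g (a - x)) \<le> 0"
    using ab J by (subst (asm) measure_posterior_Icc) auto
  moreover have "0 < w / evidence x * (G g (b - x) - G g (a - x))"
    using ab w evidence_pos[of x] by (auto simp: G_less_iff)
  ultimately show False by simp
qed

lemma level_set_eqI_measure:
  assumes "measure (posterior g w lam x) (level_set g lam x c)
           = measure (posterior g w lam x) (level_set g lam x c')"
    and "0 < measure (posterior g w lam x) (level_set g lam x c')"
  shows "level_set g lam x c = level_set g lam x c'"
proof (cases "c \<le> c'")
  case True
  then show ?thesis using assms by (rule level_set_eqI_measure_le)
next
  case False
  then have "c' \<le> c" by simp
  then show ?thesis
    using assms by (intro level_set_eqI_measure_le[symmetric]) simp_all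
qed

end

section \<open>Credible sets\<close>

locale theta_min_credible = theta_min_model +
  fixes \<alpha> :: real
  assumes \<alpha>: "0 < \<alpha>" "\<alpha> < 1"
begin

text \<open>The posterior mass that the credible set has to collect outside the atom, divided by the factor
  \<open>w / evidence x\<close> that converts noise probabilities into posterior ones; see
  \<open>credible_mass_eq\<close>.\<close>

definition slab_mass :: "real \<Rightarrow> real" where
  "slab_mass x = (1 - \<alpha>) * (1 - Delta g lam x) - (1 - w) / w * \<alpha> * g x"

lemma credible_mass_eq: "1 - \<alpha> - measure (posterior g w lam x) {0} = w / evidence x * slab_mass x"
proof -
  have "w * slab_mass x = (1 - \<alpha>) * evidence x - (1 - w) * g x"
    using w by (simp add: slab_mass_def evidence_def field_simps)
  then show ?thesis
    using evidence_pos[of x] by (simp add: measure_posterior_0 diff_divide_distrib)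
qed

lemma atom_large_iff: "1 - \<alpha> \<le> measure (posterior g w lam x) {0} \<longleftrightarrow> slab_mass x \<le> 0"
proof -
  have "1 - \<alpha> \<le> measure (posterior g w lam x) {0} \<longleftrightarrow> w / evidence x * slab_mass x \<le> 0"
    using credible_mass_eq[of x] by linarith
  also have "\<dots> \<longleftrightarrow> slab_mass x \<le> 0"
    using w evidence_pos[of x] by (simp add: mult_le_0_iff not_less divide_le_0_iff)
  finally show ?thesis .
qed

lemma slab_mass_minus: "slab_mass (- x) = slab_mass x"
  by (simp add: slab_mass_def Delta_minus g_minus)

text \<open>The mass to be collected is less than the mass available outside the gap; this keeps the
  arguments of \<open>R1\<close> and \<open>R3\<close> below one, so that these radii are not \<open>\<infinity>\<close>.\<close>

lemma slab_mass_less: "slab_mass x < 1 - Delta g lam x"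
proof -
  have "0 \<le> (1 - w) / w * \<alpha> * g x" using w \<alpha> g_pos[of x] by simp
  moreover have "0 < \<alpha> * (1 - Delta g lam x)"
    using \<alpha> Delta_less_1[OF g, of lam x] by simp
  ultimately show ?thesis by (simp add: slab_mass_def algebra_simps)
qed

lemma R1_eq: "R1 g \<alpha> w lam x = Ginv g ((1 + slab_mass x) / 2)"
  unfolding R1_def slab_mass_def by (rule arg_cong[where f = "Ginv g"]) (use w in \<open>simp add: field_simps\<close>)

lemma R2_eq: "R2 g \<alpha> w lam x = Ginv g (slab_mass x + G g (lam - x))"
  unfolding R2_def slab_mass_def by (rule arg_cong[where f = "Ginv g"]) (simp add: Delta_def algebra_simps)

lemma R3_eq: "R3 g \<alpha> w lam x = Ginv g ((1 + slab_mass x + Delta g lam x) / 2)"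
  unfolding R3_def slab_mass_def by (rule arg_cong[where f = "Ginv g"]) (use w in \<open>simp add: field_simps\<close>)

lemma R1_minus: "R1 g \<alpha> w lam (- x) = R1 g \<alpha> w lam x"
  by (simp add: R1_eq slab_mass_minus)

lemma R3_minus: "R3 g \<alpha> w lam (- x) = R3 g \<alpha> w lam x"
  by (simp add: R3_eq slab_mass_minus Delta_minus)

lemma R1E:
  assumes "0 < slab_mass x"
  obtains r where "R1 g \<alpha> w lam x = ereal r" "2 * G g r = 1 + slab_mass x" "0 < r"
proof -
  have "(1 + slab_mass x) / 2 < 1" using slab_mass_less[of x] Delta_pos[of x] by simp
  then obtain r where r: "Ginv g ((1 + slab_mass x) / 2) = ereal r" "G g r = (1 + slab_mass x) / 2"
    using assms by (elim GinvE[rotated]) auto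
  have "G g 0 < G g r" using assms r by (simp add: G_0)
  then have "0 < r" by (simp add: G_less_iff)
  then show ?thesis using r by (intro that) (auto simp: R1_eq)
qed

lemma R3E:
  assumes "0 < slab_mass x"
  obtains r where "R3 g \<alpha> w lam x = ereal r" "2 * G g r = 1 + slab_mass x + Delta g lam x"
proof -
  have "0 < (1 + slab_mass x + Delta g lam x) / 2" "(1 + slab_mass x + Delta g lam x) / 2 < 1"
    using slab_mass_less[of x] Delta_pos[of x] assms by auto
  then obtain r where "Ginv g ((1 + slab_mass x + Delta g lam x) / 2) = ereal r"
      "G g r = (1 + slab_mass x + Delta g lam x) / 2"
    by (rule GinvE)
  then show ?thesis by (intro that) (auto simp: R3_eq)
qed

text \<open>The choice of \<open>c\<close> in \<open>HPD\<close> is harmless: \<open>g r\<close> is one admissible level, and any other has the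
  same positive mass and therefore the same level set.\<close>

lemma HPD_eqI:
  assumes pos: "0 < slab_mass x" and r: "0 \<le> r"
    and mass: "measure (posterior g w lam x) ({x - r..x + r} - {- lam<..<lam}) = w / evidence x * slab_mass x"
  shows "HPD g \<alpha> w lam x = ({x - r..x + r} - {- lam<..<lam}) \<union> ({0} - {1 - w})"
proof -
  define P where "P c \<longleftrightarrow> measure (posterior g w lam x) (level_set g lam x c)
      = 1 - \<alpha> - measure (posterior g w lam x) {0}" for c
  have "P (g r)" using mass r by (simp add: P_def credible_mass_eq level_set_eq_Icc)
  moreover from this have "P (SOME c. P c)" by (rule someI)
  moreover have "0 < 1 - \<alpha> - measure (posterior g w lam x) {0}"
    using pos w evidence_pos[of x] by (simp add: credible_mass_eq)
  ultimately have "level_set g lam x (SOME c. P c) = level_set g lam x (g r)"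
    by (intro level_set_eqI_measure) (auto simp: P_def)
  moreover have "\<not> 1 - \<alpha> \<le> measure (posterior g w lam x) {0}"
    using pos by (simp add: atom_large_iff)
  ultimately show ?thesis
    using r by (auto simp: HPD_def P_def level_set_eq_Icc)
qed

section \<open>The threshold for the spike\<close>

lemma t_eq_iff: "t_eq g \<alpha> w lam t \<longleftrightarrow> w \<noteq> 1 \<and> 0 \<le> t \<and> slab_mass t = 0"
proof -
  have num: "G g (t - lam) + G g (- t - lam) = 1 - Delta g lam t"
    using G_minus[of "lam - t"] by (simp add: Delta_def minus_diff_commute[of t lam])
  have "w / (1 - w) * ((1 - Delta g lam t) / g t) = \<alpha> / (1 - \<alpha>) \<longleftrightarrow> slab_mass t = 0" if "w \<noteq> 1"
    using that w \<alpha> g_pos[of t] by (simp add: slab_mass_def field_simps)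
  then show ?thesis by (auto simp: t_eq_def num)
qed

text \<open>Away from zero the gap catches less of the noise and the likelihood of the spike drops. Strictness
  comes from the second term, which is present only for \<open>w < 1\<close>.\<close>

lemma slab_mass_strict_mono:
  assumes "w \<noteq> 1" "0 \<le> s" "s < t"
  shows "slab_mass s < slab_mass t"
proof -
  have "0 < (1 - w) / w * \<alpha>" using assms w \<alpha> by simp
  moreover have "g t < g s" using assms by (simp add: g_less_iff)
  ultimately have "(1 - w) / w * \<alpha> * g t < (1 - w) / w * \<alpha> * g s"
    by (rule mult_strict_left_mono[rotated])
  moreover have "(1 - \<alpha>) * (1 - Delta g lam s) \<le> (1 - \<alpha>) * (1 - Delta g lam t)"
    using Delta_antimono[OF assms(2,3)] \<alpha> by simp
  ultimately show ?thesis unfolding slab_mass_def by linarith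
qed

lemma continuous_on_slab_mass: "continuous_on A slab_mass"
  unfolding slab_mass_def Delta_def
  by (intro continuous_intros continuous_on_compose2[OF continuous_on_G[of UNIV]] continuous_on_g) auto

text \<open>The first term of \<open>slab_mass\<close> never drops below its positive value at zero, whereas the second tends to
  zero like \<open>1 / t\<close> at least.\<close>

lemma slab_mass_eventually_nonneg: "\<exists>t\<ge>s. 0 \<le> slab_mass t"
proof -
  define k where "k = (1 - \<alpha>) * (1 - Delta g lam 0)"
  define K where "K = (1 - w) / w * \<alpha>"
  have k: "0 < k" using \<alpha> Delta_less_1[OF g, of lam 0] by (simp add: k_def)
  define t where "t = max (max s 1) (K / k)"
  have t: "0 < t" "s \<le> t" "K / k \<le> t" by (auto simp: t_def)
  have "K * g t \<le> k * (t * g t)"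
    using t(3) k g_pos[of t] by (simp add: field_simps)
  also have "\<dots> \<le> k" using g_le_inverse[OF t(1)] k by (simp add: mult_left_le)
  also have "\<dots> \<le> (1 - \<alpha>) * (1 - Delta g lam t)"
    using Delta_antimono[of 0 t] t(1) \<alpha> by (simp add: k_def)
  finally have "0 \<le> slab_mass t" by (simp add: slab_mass_def K_def)
  then show ?thesis using t(2) by blast
qed

text \<open>If \<open>t_alpha\<close> is finite, it is the unique nonnegative zero of the increasing function \<open>slab_mass\<close>.
  If it is not, \<open>slab_mass\<close> is positive everywhere: for \<open>w = 1\<close> the spike term is absent, and for
  \<open>w < 1\<close> a nonpositive value would force a zero by the intermediate value theorem.\<close>

lemma slab_mass_nonpos_iff_t_alpha: "slab_mass x \<le> 0 \<longleftrightarrow> ereal \<bar>x\<bar> \<le> t_alpha g \<alpha> w lam"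
proof -
  have mass_abs: "slab_mass \<bar>x\<bar> = slab_mass x" by (simp add: abs_if slab_mass_minus)
  show ?thesis
  proof (cases "\<exists>t. t_eq g \<alpha> w lam t")
    case True
    then obtain t where t: "t_eq g \<alpha> w lam t" by blast
    then have t': "w \<noteq> 1" "0 \<le> t" "slab_mass t = 0" by (auto simp: t_eq_iff)
    have "s = t" if "t_eq g \<alpha> w lam s" for s
      using slab_mass_strict_mono[of s t] slab_mass_strict_mono[of t s] that t'
      by (cases s t rule: linorder_cases) (auto simp: t_eq_iff)
    then have "(THE t. t_eq g \<alpha> w lam t) = t" using t by blast
    then have "t_alpha g \<alpha> w lam = ereal t" using True by (simp add: t_alpha_def)
    moreover have "slab_mass \<bar>x\<bar> \<le> 0 \<longleftrightarrow> \<bar>x\<bar> \<le> t"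
      using slab_mass_strict_mono[of "\<bar>x\<bar>" t] slab_mass_strict_mono[of t "\<bar>x\<bar>"] t'
      by (cases "\<bar>x\<bar>" t rule: linorder_cases) auto
    ultimately show ?thesis by (simp add: mass_abs)
  next
    case False
    have "0 < slab_mass x"
    proof (rule ccontr)
      assume "\<not> 0 < slab_mass x"
      then have neg: "slab_mass \<bar>x\<bar> \<le> 0" by (simp add: mass_abs)
      have w1: "w \<noteq> 1"
        using neg \<alpha> Delta_less_1[OF g, of lam "\<bar>x\<bar>"] by (auto simp: slab_mass_def mult_le_0_iff)
      obtain u where "\<bar>x\<bar> \<le> u" "0 \<le> slab_mass u" using slab_mass_eventually_nonneg by blast
      then obtain t where "\<bar>x\<bar> \<le> t" "slab_mass t = 0"
        using IVT'[of slab_mass "\<bar>x\<bar>" 0 u] neg continuous_on_slab_mass by auto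
      then show False using False w1 by (force simp: t_eq_iff)
    qed
    then show ?thesis using False by (simp add: t_alpha_def)
  qed
qed

lemma T_set_iff: "x \<in> T_set g \<alpha> w lam \<longleftrightarrow> 0 < slab_mass x"
  using slab_mass_nonpos_iff_t_alpha[of x] by (auto simp: T_set_def not_le[symmetric])

section \<open>The four regimes\<close>

lemma X_I_minus: "- x \<in> X_I g \<alpha> w lam \<longleftrightarrow> x \<in> X_I g \<alpha> w lam"
  by (simp add: X_I_def T_set_def R1_minus)

lemma X_III_minus: "- x \<in> X_III g \<alpha> w lam \<longleftrightarrow> x \<in> X_III g \<alpha> w lam"
  by (simp add: X_III_def T_set_def R3_minus)

lemma X_IV_iff: "x \<in> X_IV g \<alpha> w lam \<longleftrightarrow> - x \<in> X_II g \<alpha> w lam"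
  by (auto simp: X_IV_def X_II_def T_set_def)

text \<open>Applying \<open>G\<close> turns the regimes into inequalities between real numbers. In these, disjointness and
  coverage become linear arithmetic, with \<open>Delta\<close> itself a difference of values of \<open>G\<close>.\<close>

lemma X_I_iff:
  "x \<in> X_I g \<alpha> w lam \<longleftrightarrow> 0 < slab_mass x \<and> 1 + slab_mass x < 2 * G g (\<bar>x\<bar> - lam)"
proof (cases "0 < slab_mass x")
  case True
  then obtain r where r: "R1 g \<alpha> w lam x = ereal r" "2 * G g r = 1 + slab_mass x" by (rule R1E)
  have "lam + r < \<bar>x\<bar> \<longleftrightarrow> G g r < G g (\<bar>x\<bar> - lam)" by (auto simp: G_less_iff)
  then show ?thesis using True r by (auto simp: X_I_def T_set_iff)
qed (simp add: X_I_def T_set_iff)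

lemma X_II_iff:
  "x \<in> X_II g \<alpha> w lam \<longleftrightarrow> 0 < slab_mass x \<and> 1 + slab_mass x + Delta g lam x < 2 * G g (x + lam)
     \<and> 2 * G g (x - lam) \<le> 1 + slab_mass x"
proof (cases "0 < slab_mass x")
  case True
  obtain r where r: "R1 g \<alpha> w lam x = ereal r" "2 * G g r = 1 + slab_mass x" using True by (rule R1E)
  obtain s where s: "R3 g \<alpha> w lam x = ereal s" "2 * G g s = 1 + slab_mass x + Delta g lam x"
    using True by (rule R3E)
  have "x \<le> lam + r \<longleftrightarrow> G g (x - lam) \<le> G g r" "s < x + lam \<longleftrightarrow> G g s < G g (x + lam)"
    by (auto simp: G_less_iff G_le_iff)
  then show ?thesis using True r s by (auto simp: X_II_def T_set_iff)
qed (simp add: X_II_def T_set_iff)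

lemma X_III_iff:
  "x \<in> X_III g \<alpha> w lam \<longleftrightarrow> 0 < slab_mass x \<and> 2 * G g (\<bar>x\<bar> + lam) \<le> 1 + slab_mass x + Delta g lam x"
proof (cases "0 < slab_mass x")
  case True
  obtain s where s: "R3 g \<alpha> w lam x = ereal s" "2 * G g s = 1 + slab_mass x + Delta g lam x"
    using True by (rule R3E)
  have "\<bar>x\<bar> \<le> - lam + s \<longleftrightarrow> G g (\<bar>x\<bar> + lam) \<le> G g s" by (auto simp: G_le_iff)
  then show ?thesis using True s by (auto simp: X_III_def T_set_iff)
qed (simp add: X_III_def T_set_iff)

lemma Delta_abs: "Delta g lam x = G g (\<bar>x\<bar> + lam) - G g (\<bar>x\<bar> - lam)"
  using Delta_minus[of x] by (cases "0 \<le> x") (auto simp: Delta_alt)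

lemma X_I_X_III_disjoint: "x \<in> X_I g \<alpha> w lam \<Longrightarrow> x \<notin> X_III g \<alpha> w lam"
  using Delta_pos[of x] by (auto simp: X_I_iff X_III_iff Delta_abs)

text \<open>These facts single out the branch of \<open>U\<close> that applies, both at \<open>x\<close> and at \<open>- x\<close>. The delicate
  point is that \<open>x\<close> and \<open>- x\<close> cannot both lie in the second regime.\<close>

lemma X_II_disjoint:
  assumes "x \<in> X_II g \<alpha> w lam"
  shows "x \<notin> X_I g \<alpha> w lam" "x \<notin> X_III g \<alpha> w lam" "- x \<notin> X_II g \<alpha> w lam"
proof -
  have II: "0 < slab_mass x" "1 + slab_mass x + Delta g lam x < 2 * G g (x + lam)" "2 * G g (x - lam) \<le> 1 + slab_mass x"
    using assms by (auto simp: X_II_iff)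
  have "G g (x + lam) \<le> G g (\<bar>x\<bar> + lam)" by (simp add: G_le_iff)
  then show "x \<notin> X_III g \<alpha> w lam" using II by (auto simp: X_III_iff)
  \<comment> \<open>The lower bound that defines the second regime fails at \<open>- \<bar>x\<bar>\<close>: with \<open>Delta\<close> written out, it
    would make the positive number \<open>slab_mass x\<close> smaller than \<open>G (lam - \<bar>x\<bar>) - G (lam + \<bar>x\<bar>)\<close>.\<close>
  have anti: "\<not> 1 + slab_mass x + Delta g lam x < 2 * G g (lam - \<bar>x\<bar>)"
  proof
    assume "1 + slab_mass x + Delta g lam x < 2 * G g (lam - \<bar>x\<bar>)"
    moreover have "G g (lam - \<bar>x\<bar>) \<le> G g (lam + \<bar>x\<bar>)" by (simp add: G_le_iff)
    ultimately show False
      using II(1) G_minus[of "lam - \<bar>x\<bar>"] by (simp add: Delta_abs add.commute)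
  qed
  then show "- x \<notin> X_II g \<alpha> w lam"
    using II(2) by (cases "0 \<le> x") (auto simp: X_II_iff slab_mass_minus Delta_minus add.commute)
  show "x \<notin> X_I g \<alpha> w lam"
  proof (cases "0 \<le> x")
    case False
    then have "\<not> G g (x + lam) \<le> G g (lam - \<bar>x\<bar>)" using II(2) anti by simp
    then show ?thesis using False by (simp add: G_le_iff)
  qed (use II in \<open>auto simp: X_I_iff\<close>)
qed

lemma regimes_cover:
  assumes "0 < slab_mass x" "x \<notin> X_I g \<alpha> w lam" "x \<notin> X_III g \<alpha> w lam"
  shows "x \<in> X_II g \<alpha> w lam \<or> - x \<in> X_II g \<alpha> w lam"
  using assms by (cases "0 \<le> x") (auto simp: X_I_iff X_III_iff X_II_iff slab_mass_minus Delta_minus)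

lemma U_X_I: "x \<in> X_I g \<alpha> w lam \<Longrightarrow> U g \<alpha> w lam x = ereal x + R1 g \<alpha> w lam x"
  by (simp add: U_def)

lemma U_X_II: "x \<in> X_II g \<alpha> w lam \<Longrightarrow> U g \<alpha> w lam x = ereal x + R2 g \<alpha> w lam x"
  using X_II_disjoint by (simp add: U_def)

lemma U_X_III: "x \<in> X_III g \<alpha> w lam \<Longrightarrow> U g \<alpha> w lam x = ereal x + R3 g \<alpha> w lam x"
  using X_I_X_III_disjoint X_II_disjoint by (auto simp: U_def)

lemma U_X_IV: "- x \<in> X_II g \<alpha> w lam \<Longrightarrow> U g \<alpha> w lam x = ereal (- lam)"
  using X_II_disjoint[of "- x"] by (auto simp: U_def X_IV_iff X_I_minus X_III_minus)

text \<open>The argument of \<open>R2\<close> can exceed one in general; the lower bound of the second regime rules this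
  out. The two bounds on \<open>r\<close> say that \<open>[x - r, x + r]\<close> reaches \<open>lam\<close> but not \<open>- lam\<close>.\<close>

lemma R2E:
  assumes "x \<in> X_II g \<alpha> w lam"
  obtains r where "R2 g \<alpha> w lam x = ereal r" "G g r = slab_mass x + G g (lam - x)"
    "\<bar>x - lam\<bar> \<le> r" "r < x + lam"
proof -
  have II: "0 < slab_mass x" "1 + slab_mass x + Delta g lam x < 2 * G g (x + lam)" "2 * G g (x - lam) \<le> 1 + slab_mass x"
    using assms by (auto simp: X_II_iff)
  have G_lam: "G g (lam - x) = 1 - G g (x - lam)" using G_minus[of "x - lam"] by simp
  have p: "slab_mass x + G g (lam - x) < G g (x + lam)" using II(2) by (simp add: Delta_alt G_lam)
  have "0 < slab_mass x + G g (lam - x)" "slab_mass x + G g (lam - x) < 1"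
    using II(1) G_pos[of "lam - x"] p G_less_1[of "x + lam"] by linarith+
  then obtain r where r: "Ginv g (slab_mass x + G g (lam - x)) = ereal r" "G g r = slab_mass x + G g (lam - x)"
    by (rule GinvE)
  have "G g (lam - x) < G g r" "G g (x - lam) \<le> G g r" "G g r < G g (x + lam)"
    using r(2) II(1,3) p by (auto simp: G_lam)
  then have "\<bar>x - lam\<bar> \<le> r" "r < x + lam" by (auto simp: G_less_iff G_le_iff)
  then show ?thesis using r by (intro that) (auto simp: R2_eq)
qed

section \<open>The credible set in each regime\<close>

lemma HPD_X_I:
  assumes "x \<in> X_I g \<alpha> w lam"
  shows "HPD g \<alpha> w lam x = ({\<theta>. L g \<alpha> w lam x \<le> ereal \<theta> \<and> ereal \<theta> \<le> U g \<alpha> w lam x}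
    - {- lam<..<lam}) \<union> ({0} - {1 - w})"
proof -
  have pos: "0 < slab_mass x" using assms by (simp add: X_I_iff)
  obtain r where r: "R1 g \<alpha> w lam x = ereal r" "2 * G g r = 1 + slab_mass x" "0 < r" using pos by (rule R1E)
  have far: "lam + r < \<bar>x\<bar>" using assms r by (simp add: X_I_def)
  have "measure (posterior g w lam x) {x - r..x + r} = w / evidence x * slab_mass x"
    using r far by (subst measure_posterior_Icc) (auto simp: G_minus abs_if split: if_splits)
  moreover have "{x - r..x + r} - {- lam<..<lam} = {x - r..x + r}" using far by auto
  ultimately have "HPD g \<alpha> w lam x = ({x - r..x + r} - {- lam<..<lam}) \<union> ({0} - {1 - w})"
    using pos r by (intro HPD_eqI) auto
  moreover have "U g \<alpha> w lam x = ereal (x + r)" "L g \<alpha> w lam x = ereal (x - r)"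
    using assms r by (simp_all add: L_def U_X_I X_I_minus R1_minus)
  ultimately show ?thesis by (simp add: atLeastAtMost_def atLeast_def atMost_def Collect_conj_eq)
qed

text \<open>Only \<open>[lam, x + r]\<close> survives the removal of the gap. The lower endpoint \<open>L\<close> is \<open>lam\<close> because
  \<open>- x\<close> lies in the fourth regime, where \<open>U\<close> is \<open>- lam\<close>.\<close>

lemma HPD_X_II:
  assumes "x \<in> X_II g \<alpha> w lam"
  shows "HPD g \<alpha> w lam x = ({\<theta>. L g \<alpha> w lam x \<le> ereal \<theta> \<and> ereal \<theta> \<le> U g \<alpha> w lam x}
    - {- lam<..<lam}) \<union> ({0} - {1 - w})"
proof -
  have pos: "0 < slab_mass x" using assms by (simp add: X_II_iff)
  obtain r where r: "R2 g \<alpha> w lam x = ereal r" "G g r = slab_mass x + G g (lam - x)"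
    "\<bar>x - lam\<bar> \<le> r" "r < x + lam" using assms by (rule R2E)
  have set: "{x - r..x + r} - {- lam<..<lam} = {lam..x + r}" using r(3,4) lam by auto
  have "measure (posterior g w lam x) {lam..x + r} = w / evidence x * slab_mass x"
    using r by (subst measure_posterior_Icc) auto
  then have "HPD g \<alpha> w lam x = {lam..x + r} \<union> ({0} - {1 - w})"
    using pos r set by (subst HPD_eqI[of x r]) auto
  moreover have "U g \<alpha> w lam x = ereal (x + r)" "L g \<alpha> w lam x = ereal lam"
    using assms r by (simp_all add: L_def U_X_II U_X_IV)
  moreover have "{\<theta>. lam \<le> \<theta> \<and> \<theta> \<le> x + r} - {- lam<..<lam} = {lam..x + r}" using lam by auto
  ultimately show ?thesis by simp
qed

lemma HPD_X_III:
  assumes "x \<in> X_III g \<alpha> w lam"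
  shows "HPD g \<alpha> w lam x = ({\<theta>. L g \<alpha> w lam x \<le> ereal \<theta> \<and> ereal \<theta> \<le> U g \<alpha> w lam x}
    - {- lam<..<lam}) \<union> ({0} - {1 - w})"
proof -
  interpret post: finite_measure "posterior g w lam x" by (rule posterior_finite)
  have pos: "0 < slab_mass x" using assms by (simp add: X_III_iff)
  obtain r where r: "R3 g \<alpha> w lam x = ereal r" "2 * G g r = 1 + slab_mass x + Delta g lam x"
    using pos by (rule R3E)
  have wide: "\<bar>x\<bar> \<le> r - lam" using assms r by (simp add: X_III_def)
  have "{x - r..x + r} - {- lam<..<lam} = {x - r..- lam} \<union> {lam..x + r}"
    using wide lam by auto
  then have "measure (posterior g w lam x) ({x - r..x + r} - {- lam<..<lam})
      = measure (posterior g w lam x) {x - r..- lam} + measure (posterior g w lam x) {lam..x + r}"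
    using lam by (simp only:) (rule post.finite_measure_Union, auto)
  also have "\<dots> = w / evidence x * (G g (- lam - x) - G g (- r) + (G g r - G g (lam - x)))"
    unfolding distrib_left
    using wide lam by (subst (1 2) measure_posterior_Icc) auto
  also have "\<dots> = w / evidence x * slab_mass x"
    using r(2) by (simp add: G_minus Delta_def)
  finally have "HPD g \<alpha> w lam x = ({x - r..x + r} - {- lam<..<lam}) \<union> ({0} - {1 - w})"
    using pos wide lam by (intro HPD_eqI) auto
  moreover have "U g \<alpha> w lam x = ereal (x + r)" "L g \<alpha> w lam x = ereal (x - r)"
    using assms r by (simp_all add: L_def U_X_III X_III_minus R3_minus)
  ultimately show ?thesis by (simp add: atLeastAtMost_def atLeast_def atMost_def Collect_conj_eq)
qed

lemma HPD_X_IV: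
  assumes "- x \<in> X_II g \<alpha> w lam"
  shows "HPD g \<alpha> w lam x = ({\<theta>. L g \<alpha> w lam x \<le> ereal \<theta> \<and> ereal \<theta> \<le> U g \<alpha> w lam x}
    - {- lam<..<lam}) \<union> ({0} - {1 - w})"
proof -
  have pos: "0 < slab_mass x" using assms by (simp add: X_II_iff slab_mass_minus)
  obtain r where r: "R2 g \<alpha> w lam (- x) = ereal r" "G g r = slab_mass (- x) + G g (lam - - x)"
    "\<bar>- x - lam\<bar> \<le> r" "r < - x + lam" using assms by (rule R2E)
  have set: "{x - r..x + r} - {- lam<..<lam} = {x - r..- lam}" using r(3,4) lam by auto
  have "measure (posterior g w lam x) {x - r..- lam} = w / evidence x * slab_mass x"
    using r lam G_minus[of "lam + x"] by (subst measure_posterior_Icc) (auto simp: G_minus slab_mass_minus)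
  then have "HPD g \<alpha> w lam x = {x - r..- lam} \<union> ({0} - {1 - w})"
    using pos r set by (subst HPD_eqI[of x r]) auto
  moreover have "U g \<alpha> w lam x = ereal (- lam)" "L g \<alpha> w lam x = ereal (x - r)"
    using assms r by (simp_all add: L_def U_X_II U_X_IV)
  moreover have "{\<theta>. x - r \<le> \<theta> \<and> \<theta> \<le> - lam} - {- lam<..<lam} = {x - r..- lam}" using lam by auto
  ultimately show ?thesis by simp
qed

end

theorem theorem2p4:
  fixes g :: "real \<Rightarrow> real" and \<alpha> w lam x :: real
  assumes "g \<in> dens_class"
    and "0 < \<alpha>" "\<alpha> < 1"
    and "0 < w" "w \<le> 1"
    and "0 < lam"
  shows "(ereal \<bar>x\<bar> \<le> t_alpha g \<alpha> w lam \<longrightarrow> HPD g \<alpha> w lam x = {0}) \<and>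
         (t_alpha g \<alpha> w lam < ereal \<bar>x\<bar> \<longrightarrow>
            HPD g \<alpha> w lam x =
              ({\<theta>. L g \<alpha> w lam x \<le> ereal \<theta> \<and> ereal \<theta> \<le> U g \<alpha> w lam x} - {- lam<..<lam})
              \<union> ({0} - {1 - w}))"
proof -
  interpret theta_min_credible g w lam \<alpha>
    using assms by unfold_locales
  show ?thesis
  proof (intro conjI impI)
    assume "ereal \<bar>x\<bar> \<le> t_alpha g \<alpha> w lam"
    then show "HPD g \<alpha> w lam x = {0}"
      by (simp add: HPD_def atom_large_iff slab_mass_nonpos_iff_t_alpha)
  next
    assume "t_alpha g \<alpha> w lam < ereal \<bar>x\<bar>"
    then have "0 < slab_mass x" using T_set_iff[of x] by (simp add: T_set_def)
    then show "HPD g \<alpha> w lam x =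
        ({\<theta>. L g \<alpha> w lam x \<le> ereal \<theta> \<and> ereal \<theta> \<le> U g \<alpha> w lam x} - {- lam<..<lam}) \<union> ({0} - {1 - w})"
      using regimes_cover[of x] HPD_X_I HPD_X_II HPD_X_III HPD_X_IV by blast
  qed
qed

end
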